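(* Let $\mathcal{H}=\{G_1,\dots,G_k\}$ be a family of pairwise disjoint non-trivial connected graphs and let $G[\mathcal{H}]$ be a non-bipartite graph obtained by point-attaching from $\mathcal{H}$. Then $$\dim_l(G[\mathcal{H}])=\sum_{j\in J_{\mathcal{H}}}\rho_j.$$
   Context: All graphs are finite, simple. For a connected graph $G$, $d_G(x,y)$ is the length of a shortest $x$–$y$ path. A set $W\subseteq V(G)$ is a local metric generator for $G$ if for every pair of adjacent vertices $u,v$ there is $w\in W$ with $d_G(u,w)\neq d_G(v,w)$. The local metric dimension $\dim_l(G)$ is the minimum cardinality of a local metric generator. Point-attaching: starting from $G_1$, for $i=1,\dots,k-1$, select a vertex of the already constructed graph and a vertex of $G_{i+1}$ and identify them; the result $G[\mathcal{H}]$ is obtained by point-attaching from $G_1,\dots,G_k$, and the $G_i$ (viewed as subgraphs of $G[\mathcal{H}]$) are its primary subgraphs. Attachment vertices are the vertices of $G[\mathcal{H}]$ obtained by identifying vertices of different primary subgraphs. For an attachment vertex $x$ and a primary subgraph $G_j$ with $x\in V(G_j)$, $G_j(x^+)$ is the connected component containing $x$ of the graph obtained from $G[\mathcal{H}]$ by removing all edges joining $x$ to vertices of $G_j$. $J_{\mathcal{H}}$ is the set of indices $j$ with $G_j$ not bipartite. For $j\in J_{\mathcal{H}}$, $C_j$ is the set of attachment vertices $x\in V(G_j)$ such that $G_j(x^+)$ is not bipartite, and $\rho_j=\min\{|S| : S\subseteq V(G_j),\ S\cup C_j \text{ is a local metric generator for } G_j\}$. *)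

theory Defs
  imports "Graph_Theory.Pair_Digraph" "Graph_Theory.Digraph_Component"
begin

text \<open>
  Finite simple graphs are objects of the locale \<^locale>\<open>pair_graph\<close>: finite, loop-free,
  symmetric digraphs without parallel arcs, so an edge \<open>{u, v}\<close> is the pair of arcs
  \<open>(u, v)\<close>, \<open>(v, u)\<close>.
\<close>

definition bipartite :: "('a, 'b) pre_digraph \<Rightarrow> bool" where
  "bipartite G \<longleftrightarrow> (\<exists>U W. verts G = U \<union> W \<and> U \<inter> W = {} \<and>
     (\<forall>u v. u \<rightarrow>\<^bsub>G\<^esub> v \<longrightarrow> (u \<in> U \<and> v \<in> W) \<or> (u \<in> W \<and> v \<in> U)))"

definition gdist :: "'a pair_pre_digraph \<Rightarrow> 'a \<Rightarrow> 'a \<Rightarrow> nat" where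
  "gdist G u v = (LEAST n. \<exists>p. pre_digraph.apath (with_proj G) u p v \<and> length p = n)"

definition local_metric_generator :: "'a pair_pre_digraph \<Rightarrow> 'a set \<Rightarrow> bool" where
  "local_metric_generator G W \<longleftrightarrow> W \<subseteq> pverts G \<and>
     (\<forall>u v. (u, v) \<in> parcs G \<longrightarrow> (\<exists>w\<in>W. gdist G u w \<noteq> gdist G v w))"

definition local_metric_dim :: "'a pair_pre_digraph \<Rightarrow> nat" where
  "local_metric_dim G = Min {card W | W. local_metric_generator G W}"


definition graph_union ::
    "'a pair_pre_digraph \<Rightarrow> 'a pair_pre_digraph \<Rightarrow> 'a pair_pre_digraph" where
  "graph_union G H = \<lparr> pverts = pverts G \<union> pverts H, parcs = parcs G \<union> parcs H \<rparr>"

text \<open>The vertex resulting from the identification of \<open>x\<close> and \<open>y\<close> is called \<open>x\<close>.\<close>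

definition identify :: "'a \<Rightarrow> 'a \<Rightarrow> 'a pair_pre_digraph \<Rightarrow> 'a pair_pre_digraph" where
  "identify x y G = (let f = id(y := x) in
     \<lparr> pverts = f ` pverts G, parcs = map_prod f f ` parcs G \<rparr>)"

text \<open>
  \<open>point_attaching Gs G Ps\<close>: the graph \<open>G\<close> arises by point-attaching from the list \<open>Gs\<close> of
  pairwise disjoint graphs, and \<open>Ps ! i\<close> is \<open>Gs ! i\<close> viewed as a (primary) subgraph of \<open>G\<close>.
\<close>

inductive point_attaching ::
    "'a pair_pre_digraph list \<Rightarrow> 'a pair_pre_digraph \<Rightarrow> 'a pair_pre_digraph list \<Rightarrow> bool" where
  start: "point_attaching [G] G [G]"
| attach: "\<lbrakk>point_attaching Gs G Ps; x \<in> pverts G; y \<in> pverts H\<rbrakk> \<Longrightarrow>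
     point_attaching (Gs @ [H]) (identify x y (graph_union G H)) (map (identify x y) (Ps @ [H]))"

definition attachment_vertices :: "'a pair_pre_digraph list \<Rightarrow> 'a set" where
  "attachment_vertices Ps =
     {x. \<exists>i < length Ps. \<exists>j < length Ps. i \<noteq> j \<and> x \<in> pverts (Ps ! i) \<and> x \<in> pverts (Ps ! j)}"

definition remove_edges_at ::
    "'a pair_pre_digraph \<Rightarrow> 'a \<Rightarrow> 'a set \<Rightarrow> 'a pair_pre_digraph" where
  "remove_edges_at G x A = G\<lparr> parcs := parcs G - ({x} \<times> A \<union> A \<times> {x}) \<rparr>"

text \<open>
  \<open>branch G P x\<close> is the graph \<open>P(x\<^sup>+)\<close>.  As the graph is symmetric, its strongly connected
  components are its connected components.
\<close>

definition branch ::
    "'a pair_pre_digraph \<Rightarrow> 'a pair_pre_digraph \<Rightarrow> 'a \<Rightarrow> ('a, 'a \<times> 'a) pre_digraph" where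
  "branch G P x = (let H = with_proj (remove_edges_at G x (pverts P)) in
     H \<restriction> pre_digraph.scc_of H x)"

definition nonbip_indices :: "'a pair_pre_digraph list \<Rightarrow> nat set" where
  "nonbip_indices Ps = {j. j < length Ps \<and> \<not> bipartite (with_proj (Ps ! j))}"

definition nonbip_attachments ::
    "'a pair_pre_digraph \<Rightarrow> 'a pair_pre_digraph list \<Rightarrow> nat \<Rightarrow> 'a set" where
  "nonbip_attachments G Ps j =
     {x \<in> attachment_vertices Ps \<inter> pverts (Ps ! j). \<not> bipartite (branch G (Ps ! j) x)}"

definition rho :: "'a pair_pre_digraph \<Rightarrow> 'a pair_pre_digraph list \<Rightarrow> nat \<Rightarrow> nat" where
  "rho G Ps j = Min {card S | S. S \<subseteq> pverts (Ps ! j) \<and>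
     local_metric_generator (Ps ! j) (S \<union> nonbip_attachments G Ps j)}"

end

theory Submission
  imports Defs
begin

text \<open>
  Every primary subgraph \<open>P\<^sub>j\<close> is a retract of the whole graph: each vertex \<open>w\<close> reaches \<open>P\<^sub>j\<close> through a
  single vertex \<open>r\<^sub>j w\<close>, so \<open>d(u, w) = d\<^sub>j(u, r\<^sub>j w) + d(r\<^sub>j w, w)\<close> for \<open>u\<close> in \<open>P\<^sub>j\<close>, and \<open>w\<close> distinguishes an
  edge of \<open>P\<^sub>j\<close> iff \<open>r\<^sub>j w\<close> does so in \<open>P\<^sub>j\<close>. The branch at \<open>x\<close> is the fibre of \<open>r\<^sub>j\<close> over \<open>x\<close>.

  Upper bound: choose optimal sets \<open>S\<^sub>j\<close> for the non-bipartite \<open>P\<^sub>j\<close>. A vertex of \<open>C\<^sub>j\<close> is imitated by any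
  chosen vertex in its branch. There is one: a farthest non-bipartite \<open>P\<^sub>i\<close> in that branch has at most
  one element in \<open>C\<^sub>i\<close>, and a single vertex never generates a non-bipartite graph, so \<open>S\<^sub>i\<close> is nonempty.
  Edges of bipartite \<open>P\<^sub>j\<close> are distinguished by every vertex, for parity reasons.

  Lower bound: if \<open>W\<close> generates, then \<open>r\<^sub>j(W) - C\<^sub>j\<close> is admissible for \<open>\<rho>\<^sub>j\<close>, and for each \<open>w\<close> there is at
  most one non-bipartite \<open>P\<^sub>j\<close> with \<open>r\<^sub>j w \<notin> C\<^sub>j\<close>: of two such subgraphs, one lies on the same side of
  the other as \<open>w\<close>.
\<close>

section \<open>Distances and bipartiteness\<close>

text \<open>In all applications \<open>f\<close> is the distance to a fixed vertex, whose parity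
  then serves as a 2-colouring.\<close>

lemma bipartite_if_parity:
  fixes f :: "'a \<Rightarrow> nat"
  assumes "\<And>u v. u \<rightarrow>\<^bsub>G\<^esub> v \<Longrightarrow> u \<in> verts G \<and> v \<in> verts G \<and> even (f u) \<noteq> even (f v)"
  shows "bipartite G"
  unfolding bipartite_def
  by (rule exI[of _ "{u \<in> verts G. even (f u)}"], rule exI[of _ "{u \<in> verts G. odd (f u)}"])
    (use assms in blast)

lemma bipartite_subgraph:
  assumes "bipartite H" "verts G \<subseteq> verts H" "\<And>u v. u \<rightarrow>\<^bsub>G\<^esub> v \<Longrightarrow> u \<rightarrow>\<^bsub>H\<^esub> v"
    and "\<And>u v. u \<rightarrow>\<^bsub>G\<^esub> v \<Longrightarrow> u \<in> verts G \<and> v \<in> verts G"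
  shows "bipartite G"
proof -
  obtain U W where UW: "verts H = U \<union> W" "U \<inter> W = {}"
    "\<And>u v. u \<rightarrow>\<^bsub>H\<^esub> v \<Longrightarrow> (u \<in> U \<and> v \<in> W) \<or> (u \<in> W \<and> v \<in> U)"
    using assms(1) unfolding bipartite_def by blast
  show ?thesis
    unfolding bipartite_def
    by (rule exI[of _ "U \<inter> verts G"], rule exI[of _ "W \<inter> verts G"])
      (use UW assms(2-4) in blast)
qed

lemma relpow_subset:
  fixes R S :: "'a rel"
  assumes "R \<subseteq> S"
  shows "R ^^ n \<subseteq> S ^^ n"
  by (induction n) (simp_all add: relcomp_mono assms)

section \<open>Distances through powers of the arc relation\<close>

context pair_wf_digraph
begin

lemma relpow_imp_awalk:
  assumes "u \<in> pverts G" "(u, v) \<in> parcs G ^^ n"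
  shows "\<exists>p. awalk u p v \<and> length p = n"
  using assms
proof (induction n arbitrary: u)
  case 0
  then show ?case by (auto simp: awalk_Nil_iff)
next
  case (Suc n)
  then obtain w where w: "(u, w) \<in> parcs G" "(w, v) \<in> parcs G ^^ n"
    by (meson relpow_Suc_D2)
  then obtain p where "awalk w p v" "length p = n"
    using Suc.IH in_arcsD2 by blast
  then show ?case
    using w(1) by (intro exI[of _ "(u, w) # p"]) (auto simp: awalk_Cons_iff)
qed

lemma awalk_imp_relpow: "awalk u p v \<Longrightarrow> (u, v) \<in> parcs G ^^ length p"
proof (induction p arbitrary: u)
  case (Cons e p)
  then have "(u, snd e) \<in> parcs G" "(snd e, v) \<in> parcs G ^^ length p"
    by (auto simp: awalk_Cons_iff)
  then show ?case by (metis length_Cons relpow_Suc_I2)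
qed (simp add: awalk_Nil_iff)

text \<open>\<open>gdist\<close> minimises over paths, whereas the arguments below produce walks;
  cutting out cycles never lengthens a walk.\<close>

lemma length_awalk_to_apath:
  assumes "awalk u p v"
  shows "length (awalk_to_apath p) \<le> length p"
  using assms
proof (induct rule: awalk_to_apath_induct)
  case (path p)
  then have "awalk_to_apath p = p"
    by (auto simp: awalk_to_apath.simps)
  then show ?case by simp
next
  case (decomp p q r s)
  then have "awalk_to_apath p = awalk_to_apath (q @ s)"
    using step_awalk_to_apath by blast
  moreover have "p = q @ r @ s"
    using decomp by (auto elim!: awalk_cyc_decompE)
  ultimately show ?case using decomp by simp
qed

text \<open>Together with \<open>gdist_relpow\<close> this makes \<open>gdist G u v\<close> the
  least exponent \<open>n\<close> with \<open>(u, v)\<close> in \<open>parcs G ^^ n\<close>, so that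
  paths can be forgotten afterwards.\<close>

lemma gdist_le:
  assumes "u \<in> pverts G" "(u, v) \<in> parcs G ^^ n"
  shows "gdist G u v \<le> n"
proof -
  obtain p where p: "awalk u p v" "length p = n"
    using relpow_imp_awalk assms by blast
  have "gdist G u v \<le> length (awalk_to_apath p)"
    unfolding gdist_def using apath_awalk_to_apath[OF p(1)] by (blast intro: Least_le)
  with length_awalk_to_apath[OF p(1)] p(2) show ?thesis by simp
qed

lemma gdist_relpow:
  assumes "u \<in> pverts G" "(u, v) \<in> (parcs G)\<^sup>*"
  shows "(u, v) \<in> parcs G ^^ gdist G u v"
proof -
  obtain p where "awalk u p v"
    using assms relpow_imp_awalk rtrancl_imp_relpow by metis
  then have "\<exists>n p. apath u p v \<and> length p = n"
    using apath_awalk_to_apath by blast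
  then have "\<exists>p. apath u p v \<and> length p = gdist G u v"
    unfolding gdist_def by (rule LeastI_ex)
  then show ?thesis using awalk_imp_relpow awalkI_apath by metis
qed

end

locale connected_pair_graph = pair_graph +
  assumes reach: "u \<in> pverts G \<Longrightarrow> v \<in> pverts G \<Longrightarrow> (u, v) \<in> (parcs G)\<^sup>*"
begin

lemma gdist_walk: "u \<in> pverts G \<Longrightarrow> v \<in> pverts G \<Longrightarrow> (u, v) \<in> parcs G ^^ gdist G u v"
  by (simp add: gdist_relpow reach)

lemma gdist_self: "u \<in> pverts G \<Longrightarrow> gdist G u u = 0"
  using gdist_le[of u u 0] by simp

lemma gdist_adjacent_pos: "(u, v) \<in> parcs G \<Longrightarrow> gdist G v u \<noteq> 0"
  using gdist_walk[of v u] no_loops'[of u v] wellformed'[of u v] by (cases "gdist G v u") auto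

lemma gdist_adjacent_le:
  assumes "(u, v) \<in> parcs G" "c \<in> pverts G"
  shows "gdist G u c \<le> Suc (gdist G v c)"
proof (rule gdist_le)
  show "u \<in> pverts G" using assms(1) by (rule wellformed')
  have "(v, c) \<in> parcs G ^^ gdist G v c" using assms wellformed' by (blast intro: gdist_walk)
  with assms(1) show "(u, c) \<in> parcs G ^^ Suc (gdist G v c)" by (rule relpow_Suc_I2)
qed

lemma generator_verts: "local_metric_generator G (pverts G)"
  unfolding local_metric_generator_def
proof (intro conjI allI impI subset_refl)
  fix u v assume uv: "(u, v) \<in> parcs G"
  then have u: "u \<in> pverts G" by (rule wellformed')
  then have "gdist G u u \<noteq> gdist G v u" using gdist_self gdist_adjacent_pos[OF uv] by simp
  with u show "\<exists>w\<in>pverts G. gdist G u w \<noteq> gdist G v w" by blast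
qed

text \<open>A walk ends in the colour class where it started iff its length is even, and adjacent
  vertices have opposite colours.\<close>

lemma bipartite_gdist_parity:
  assumes "bipartite (with_proj G)" "(u, v) \<in> parcs G" "c \<in> pverts G"
  shows "even (gdist G u c) \<noteq> even (gdist G v c)"
proof -
  obtain U W where UW: "pverts G = U \<union> W" "U \<inter> W = {}"
    "\<And>u v. (u, v) \<in> parcs G \<Longrightarrow> (u \<in> U \<and> v \<in> W) \<or> (u \<in> W \<and> v \<in> U)"
    using assms(1) unfolding bipartite_def by auto
  have "((a, b) \<in> parcs G ^^ n \<Longrightarrow> (a \<in> U \<longleftrightarrow> b \<in> U) = even n)" for a b n
  proof (induction n arbitrary: b)
    case (Suc n)
    then obtain d where d: "(a, d) \<in> parcs G ^^ n" "(d, b) \<in> parcs G" by auto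
    have "(d \<in> U) \<noteq> (b \<in> U)" using UW(2,3) d(2) by blast
    then show ?case using Suc.IH[OF d(1)] by auto
  qed simp
  then have "(u \<in> U \<longleftrightarrow> c \<in> U) = even (gdist G u c)" "(v \<in> U \<longleftrightarrow> c \<in> U) = even (gdist G v c)"
    using gdist_walk[OF _ assms(3)] wellformed'[OF assms(2)] by simp_all
  moreover have "(u \<in> U) \<noteq> (v \<in> U)" using UW assms(2) by blast
  ultimately show ?thesis by blast
qed

text \<open>Distances to \<open>c\<close> differ by at most one along an arc. If they always
  differed, their parity would be a 2-colouring. Hence a single vertex never generates a
  non-bipartite graph.\<close>

lemma not_bipartite_equidistant:
  assumes "\<not> bipartite (with_proj G)" "c \<in> pverts G"
  obtains u v where "(u, v) \<in> parcs G" "gdist G u c = gdist G v c"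
proof (rule ccontr)
  assume "\<not> thesis"
  with that have neq: "gdist G u c \<noteq> gdist G v c" if "(u, v) \<in> parcs G" for u v
    using that by blast
  have "even (gdist G u c) \<noteq> even (gdist G v c)" if uv: "(u, v) \<in> parcs G" for u v
  proof -
    have "gdist G u c = Suc (gdist G v c) \<or> gdist G v c = Suc (gdist G u c)"
      using neq[OF uv] gdist_adjacent_le[OF uv assms(2)]
        gdist_adjacent_le[OF arcs_symmetric[OF uv] assms(2)] by linarith
    then show ?thesis by auto
  qed
  then have "bipartite (with_proj G)"
    by (intro bipartite_if_parity[of _ "\<lambda>u. gdist G u c"]) (auto dest: wellformed')
  with assms(1) show False by simp
qed

end

section \<open>Retractions onto the primary subgraphs\<close>

text \<open>
  The map \<open>ret j\<close> sends a vertex to the vertex of the primary subgraph \<open>Ps ! j\<close> through which it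
  is attached.
\<close>

locale primary_decomposition =
  fixes G :: "'a pair_pre_digraph" and Ps :: "'a pair_pre_digraph list"
    and ret :: "nat \<Rightarrow> 'a \<Rightarrow> 'a"
  assumes primary: "i < length Ps \<Longrightarrow> connected_pair_graph (Ps ! i)"
    and whole: "connected_pair_graph G"
    and parcs_eq: "parcs G = (\<Union>i<length Ps. parcs (Ps ! i))"
    and pverts_subset: "i < length Ps \<Longrightarrow> pverts (Ps ! i) \<subseteq> pverts G"
    and ret_in: "j < length Ps \<Longrightarrow> v \<in> pverts G \<Longrightarrow> ret j v \<in> pverts (Ps ! j)"
    and ret_id: "j < length Ps \<Longrightarrow> v \<in> pverts (Ps ! j) \<Longrightarrow> ret j v = v"
    and ret_arc: "j < length Ps \<Longrightarrow> i < length Ps \<Longrightarrow> i \<noteq> j \<Longrightarrow> (u, v) \<in> parcs (Ps ! i) \<Longrightarrow>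
          ret j u = ret j v"
begin

sublocale whole: connected_pair_graph G
  by (rule whole)

text \<open>Walks along these arcs stay in one fibre of \<open>ret j\<close>; the branches at
  \<open>Ps ! j\<close> are described by them.\<close>

definition outer_arcs :: "nat \<Rightarrow> 'a rel" where
  "outer_arcs j = (\<Union>i\<in>{..<length Ps} - {j}. parcs (Ps ! i))"

lemma primary_arc_verts:
  assumes "i < length Ps" "(u, v) \<in> parcs (Ps ! i)"
  shows "u \<in> pverts (Ps ! i)" "v \<in> pverts (Ps ! i)"
proof -
  interpret P: connected_pair_graph "Ps ! i" using primary assms by blast
  show "u \<in> pverts (Ps ! i)" "v \<in> pverts (Ps ! i)" using P.wellformed' assms(2) by blast+
qed

lemma parcs_cases:
  assumes "(u, v) \<in> parcs G" "j < length Ps"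
  obtains "(u, v) \<in> parcs (Ps ! j)" | "(u, v) \<in> outer_arcs j"
  using assms unfolding parcs_eq outer_arcs_def by blast

lemma outer_arcs_ret: "j < length Ps \<Longrightarrow> (u, v) \<in> outer_arcs j \<Longrightarrow> ret j u = ret j v"
  unfolding outer_arcs_def using ret_arc by blast

lemma outer_arcs_rtrancl_ret:
  assumes "j < length Ps" "(u, v) \<in> (outer_arcs j)\<^sup>*"
  shows "ret j u = ret j v"
  using assms(2) by induction (use outer_arcs_ret[OF assms(1)] in auto)

lemma outer_arcs_subset: "outer_arcs j \<subseteq> parcs G"
  unfolding outer_arcs_def parcs_eq by blast

lemma sym_outer_arcs: "sym (outer_arcs j)"
proof (rule symI)
  fix u v assume "(u, v) \<in> outer_arcs j"
  then obtain i where i: "i < length Ps" "i \<noteq> j" "(u, v) \<in> parcs (Ps ! i)"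
    unfolding outer_arcs_def by blast
  interpret P: connected_pair_graph "Ps ! i" using primary i by blast
  show "(v, u) \<in> outer_arcs j"
    using i P.arcs_symmetric unfolding outer_arcs_def by blast
qed

text \<open>Follow a walk in \<open>G\<close> from \<open>ret j w\<close> to \<open>w\<close>,
  keeping an outer walk from \<open>ret j z\<close> to the current vertex \<open>z\<close>. An outer
  arc extends it; after an arc of \<open>Ps ! j\<close> it restarts as the empty walk, because
  \<open>ret j\<close> fixes the new vertex.\<close>

lemma fibre_walk:
  assumes "j < length Ps" "w \<in> pverts G"
  shows "(ret j w, w) \<in> (outer_arcs j)\<^sup>*"
proof -
  have u: "ret j w \<in> pverts (Ps ! j)" using ret_in assms by blast
  have "(ret j w, w) \<in> (parcs G)\<^sup>*" using whole.reach u pverts_subset assms by blast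
  then show ?thesis
  proof induction
    case base
    show ?case using ret_id u assms(1) by simp
  next
    case (step y z)
    from step(2) assms(1) show ?case
    proof (cases rule: parcs_cases)
      case 1
      then have "ret j z = z" using ret_id primary_arc_verts assms(1) by blast
      then show ?thesis by simp
    next
      case 2
      then show ?thesis
        using step.IH outer_arcs_ret[OF assms(1)] by (auto intro: rtrancl_into_rtrancl)
    qed
  qed
qed

text \<open>The part outside \<open>Ps ! j\<close> grows with each outer arc. Before an arc of
  \<open>Ps ! j\<close> the walk is back at \<open>ret j y = y\<close>, so the detour of length
  \<open>b\<close> is dropped; this is why only \<open>a + b \<le> n\<close> holds.\<close>

lemma walk_through_ret:
  assumes "j < length Ps" "u \<in> pverts (Ps ! j)" "(u, w) \<in> parcs G ^^ n"
  shows "\<exists>a b. a + b \<le> n \<and> (u, ret j w) \<in> parcs (Ps ! j) ^^ a \<and> (ret j w, w) \<in> parcs G ^^ b"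
  using assms(3)
proof (induction n arbitrary: w)
  case 0
  then show ?case using ret_id assms by (auto intro!: exI[of _ 0])
next
  case (Suc n)
  then obtain y where y: "(u, y) \<in> parcs G ^^ n" "(y, w) \<in> parcs G" by auto
  then obtain a b where ab: "a + b \<le> n" "(u, ret j y) \<in> parcs (Ps ! j) ^^ a"
    "(ret j y, y) \<in> parcs G ^^ b" using Suc.IH by blast
  from y(2) assms(1) show ?case
  proof (cases rule: parcs_cases)
    case 1
    then have "ret j y = y" "ret j w = w"
      using ret_id primary_arc_verts assms(1) by blast+
    then have "(u, ret j w) \<in> parcs (Ps ! j) ^^ Suc a" "(ret j w, w) \<in> parcs G ^^ 0"
      using ab 1 by auto
    then show ?thesis using ab(1) by (intro exI[of _ "Suc a"] exI[of _ 0]) simp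
  next
    case 2
    then have "ret j y = ret j w" using outer_arcs_ret assms(1) by blast
    then have "(ret j w, w) \<in> parcs G ^^ Suc b" "(u, ret j w) \<in> parcs (Ps ! j) ^^ a"
      using ab y(2) by auto
    then show ?thesis using ab(1) by (intro exI[of _ a] exI[of _ "Suc b"]) simp
  qed
qed

text \<open>Splitting a shortest walk at \<open>ret j w\<close> gives one inequality, concatenating
  shortest walks the other.\<close>

lemma gdist_via_ret:
  assumes "j < length Ps" "u \<in> pverts (Ps ! j)" "w \<in> pverts G"
  shows "gdist G u w = gdist (Ps ! j) u (ret j w) + gdist G (ret j w) w"
proof -
  interpret P: connected_pair_graph "Ps ! j" using primary assms by blast
  have uG: "u \<in> pverts G" and rP: "ret j w \<in> pverts (Ps ! j)" and rG: "ret j w \<in> pverts G"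
    using pverts_subset ret_in assms by blast+
  obtain a b where ab: "a + b \<le> gdist G u w" "(u, ret j w) \<in> parcs (Ps ! j) ^^ a"
    "(ret j w, w) \<in> parcs G ^^ b"
    using walk_through_ret whole.gdist_walk uG assms by meson
  have "gdist (Ps ! j) u (ret j w) \<le> a" "gdist G (ret j w) w \<le> b"
    using ab P.gdist_le whole.gdist_le assms rG by auto
  moreover have "(u, ret j w) \<in> parcs G ^^ gdist (Ps ! j) u (ret j w)"
    using relpow_subset[of "parcs (Ps ! j)" "parcs G"] P.gdist_walk[OF assms(2) rP] assms(1)
    unfolding parcs_eq by blast
  then have "(u, w) \<in> parcs G ^^ (gdist (Ps ! j) u (ret j w) + gdist G (ret j w) w)"
    using whole.gdist_walk[OF rG assms(3)] by (auto simp: relpow_add)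
  then have "gdist G u w \<le> gdist (Ps ! j) u (ret j w) + gdist G (ret j w) w"
    using whole.gdist_le uG by blast
  ultimately show ?thesis using ab(1) by linarith
qed

text \<open>The summand \<open>gdist G (ret j w) w\<close> is common to both ends of the arc and
  cancels.\<close>

lemma gdist_eq_iff_ret:
  assumes "j < length Ps" "(u, v) \<in> parcs (Ps ! j)" "w \<in> pverts G"
  shows "gdist G u w = gdist G v w \<longleftrightarrow> gdist (Ps ! j) u (ret j w) = gdist (Ps ! j) v (ret j w)"
  using gdist_via_ret[OF assms(1) _ assms(3)] primary_arc_verts[OF assms(1,2)] by simp

text \<open>\<open>Ps ! i\<close> is connected and all its arcs are outer for \<open>j\<close>, so
  it lies in a single fibre of \<open>ret j\<close>.\<close>

lemma ret_primary_const:
  assumes "i < length Ps" "j < length Ps" "i \<noteq> j" "u \<in> pverts (Ps ! i)" "v \<in> pverts (Ps ! i)"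
  shows "ret j u = ret j v"
proof -
  interpret P: connected_pair_graph "Ps ! i" using primary assms by blast
  have "parcs (Ps ! i) \<subseteq> outer_arcs j" using assms unfolding outer_arcs_def by blast
  then have "(u, v) \<in> (outer_arcs j)\<^sup>*" using P.reach assms rtrancl_mono by blast
  then show ?thesis using outer_arcs_rtrancl_ret assms by blast
qed

text \<open>
  A vertex that does not lie on the same side of \<open>Ps ! i\<close> as \<open>Ps ! j\<close> lies on the same side of
  \<open>Ps ! j\<close> as \<open>Ps ! i\<close>.
\<close>

lemma ret_swap:
  assumes ij: "i < length Ps" "j < length Ps" "i \<noteq> j"
    and v: "v \<in> pverts G" and y: "y \<in> pverts (Ps ! j)" and neq: "ret i v \<noteq> ret i y"
    and x: "x \<in> pverts (Ps ! i)"
  shows "ret j v = ret j x"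
proof -
  have walk: "(ret i v, v) \<in> (outer_arcs i)\<^sup>*" using fibre_walk ij v by blast
  have s: "ret i (ret i v) = ret i v" using ret_id ret_in ij v by blast
  \<comment> \<open>The walk never uses an arc of \<open>Ps ! j\<close>: on that subgraph
    \<open>ret i\<close> is constantly \<open>ret i y\<close>, while along the walk it stays
    \<open>ret i v\<close>. Hence \<open>ret j\<close> is constant along the walk as well.\<close>
  have "ret i z = ret i v \<and> ret j z = ret j (ret i v)" if "(ret i v, z) \<in> (outer_arcs i)\<^sup>*" for z
    using that
  proof induction
    case base
    then show ?case using s by simp
  next
    case (step p q)
    then obtain k where k: "k < length Ps" "k \<noteq> i" "(p, q) \<in> parcs (Ps ! k)"
      unfolding outer_arcs_def by blast
    have "k \<noteq> j"
    proof
      assume "k = j"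
      then have "p \<in> pverts (Ps ! j)" using primary_arc_verts k by blast
      then have "ret i p = ret i y" using ret_primary_const[of j i p y] ij y by blast
      with step.IH neq show False by simp
    qed
    then have "ret j p = ret j q" "ret i p = ret i q" using ret_arc k ij by blast+
    then show ?case using step.IH by simp
  qed
  with walk have "ret j v = ret j (ret i v)" by blast
  also have "\<dots> = ret j x" using ret_primary_const ij x ret_in v by blast
  finally show ?thesis .
qed

lemma gdist_parity_primary:
  assumes "i < length Ps" "bipartite (with_proj (Ps ! i))" "(u, v) \<in> parcs (Ps ! i)" "w \<in> pverts G"
  shows "even (gdist G u w) \<noteq> even (gdist G v w)"
proof -
  interpret P: connected_pair_graph "Ps ! i" using primary assms by blast
  have "even (gdist (Ps ! i) u (ret i w)) \<noteq> even (gdist (Ps ! i) v (ret i w))"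
    using P.bipartite_gdist_parity assms ret_in by blast
  moreover have "gdist G u w = gdist (Ps ! i) u (ret i w) + gdist G (ret i w) w"
    "gdist G v w = gdist (Ps ! i) v (ret i w) + gdist G (ret i w) w"
    using gdist_via_ret[OF assms(1) _ assms(4)] primary_arc_verts[OF assms(1,3)] by blast+
  ultimately show ?thesis by (simp only: even_add) blast
qed

section \<open>Branches as fibres of the retractions\<close>

lemma outer_arcs_remaining:
  assumes "j < length Ps" "x \<in> pverts (Ps ! j)"
  shows "outer_arcs j \<subseteq> parcs (remove_edges_at G x (pverts (Ps ! j)))"
proof -
  \<comment> \<open>On such an arc \<open>ret j\<close> would be both constant and the identity,
    making it a loop. Since only pairs of vertices of \<open>Ps ! j\<close> are removed, all outer
    arcs survive.\<close>
  have "(p, q) \<notin> outer_arcs j" if "p \<in> pverts (Ps ! j)" "q \<in> pverts (Ps ! j)" for p q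
  proof
    assume pq: "(p, q) \<in> outer_arcs j"
    then have "p = q" using outer_arcs_ret ret_id assms(1) that by metis
    with pq outer_arcs_subset whole.no_loops' show False by blast
  qed
  then show ?thesis
    using outer_arcs_subset assms(2) unfolding remove_edges_at_def by auto
qed

text \<open>The component cannot leave the fibre: an arc of \<open>Ps ! j\<close> starting in the
  fibre over \<open>x\<close> starts at \<open>x\<close> itself and was removed. Conversely
  \<open>fibre_walk\<close> joins \<open>x\<close> to the whole fibre by outer arcs, which survive
  and are symmetric.\<close>

lemma verts_branch:
  assumes j: "j < length Ps" and x: "x \<in> pverts (Ps ! j)"
  shows "verts (branch G (Ps ! j) x) = {v \<in> pverts G. ret j v = x}"
proof -
  define H where "H = remove_edges_at G x (pverts (Ps ! j))"
  have H: "pverts H = pverts G"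
    "parcs H = parcs G - ({x} \<times> pverts (Ps ! j) \<union> pverts (Ps ! j) \<times> {x})"
    unfolding H_def remove_edges_at_def by simp_all
  interpret H: pair_wf_digraph H
    by unfold_locales (use H whole.wellformed' in auto)
  have xH: "x \<in> pverts H" using H pverts_subset j x by blast
  have branch: "verts (branch G (Ps ! j) x) = H.scc_of x"
    unfolding branch_def H_def[symmetric] by (simp add: Let_def)
  have reach: "u \<rightarrow>\<^sup>*\<^bsub>with_proj H\<^esub> v \<longleftrightarrow> (u, v) \<in> (parcs H)\<^sup>*" if "u \<in> pverts H" for u v
    using H.reachable_conv'[OF that] by simp
  have "ret j v = x \<and> v \<in> pverts G" if "(x, v) \<in> (parcs H)\<^sup>*" for v
    using that
  proof induction
    case base
    show ?case using ret_id j x xH H(1) by simp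
  next
    case (step p q)
    then have pq: "(p, q) \<in> parcs G" using H(2) by blast
    from pq j show ?case
    proof (cases rule: parcs_cases)
      case 1
      then have "p \<in> pverts (Ps ! j)" "q \<in> pverts (Ps ! j)" using primary_arc_verts j by blast+
      moreover from this have "p = x" using step.IH ret_id j by simp
      ultimately show ?thesis using step.hyps(2) H(2) by blast
    next
      case 2
      then have "ret j q = ret j p" using outer_arcs_ret[OF j] by simp
      then show ?thesis using step.IH whole.wellformed' pq by simp
    qed
  qed
  moreover have "(x, v) \<in> (parcs H)\<^sup>* \<and> (v, x) \<in> (parcs H)\<^sup>*" if "v \<in> pverts G" "ret j v = x" for v
  proof -
    have "(x, v) \<in> (outer_arcs j)\<^sup>*" using fibre_walk j that by blast
    moreover from this have "(v, x) \<in> (outer_arcs j)\<^sup>*"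
      using sym_rtrancl[OF sym_outer_arcs] by (rule symD[rotated])
    moreover have "(outer_arcs j)\<^sup>* \<subseteq> (parcs H)\<^sup>*"
      using outer_arcs_remaining[OF j x] H_def rtrancl_mono by blast
    ultimately show ?thesis by blast
  qed
  ultimately show ?thesis
    unfolding branch H.scc_of_def using reach xH H(1) by auto
qed

lemma branch_adjacent_iff:
  assumes "j < length Ps" "x \<in> pverts (Ps ! j)"
  shows "u \<rightarrow>\<^bsub>branch G (Ps ! j) x\<^esub> v \<longleftrightarrow> (u, v) \<in> outer_arcs j \<and> ret j u = x"
proof -
  define H where "H = remove_edges_at G x (pverts (Ps ! j))"
  have "u \<rightarrow>\<^bsub>branch G (Ps ! j) x\<^esub> v \<longleftrightarrow>
      (u, v) \<in> parcs H \<and> u \<in> verts (branch G (Ps ! j) x) \<and> v \<in> verts (branch G (Ps ! j) x)"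
    unfolding branch_def H_def[symmetric] by (auto simp: Let_def arcs_ends_conv induce_subgraph_def)
  also have "\<dots> \<longleftrightarrow> (u, v) \<in> parcs H \<and> ret j u = x \<and> ret j v = x"
    unfolding verts_branch[OF assms] H_def remove_edges_at_def using whole.wellformed' by auto
  also have "\<dots> \<longleftrightarrow> (u, v) \<in> outer_arcs j \<and> ret j u = x"
  proof
    assume uv: "(u, v) \<in> parcs H \<and> ret j u = x \<and> ret j v = x"
    then have "(u, v) \<in> parcs G" unfolding H_def remove_edges_at_def by simp
    then show "(u, v) \<in> outer_arcs j \<and> ret j u = x" using assms(1)
    proof (cases rule: parcs_cases)
      case 1
      then have "u = v" using uv ret_id primary_arc_verts assms(1) by metis
      with \<open>(u, v) \<in> parcs G\<close> whole.no_loops' show ?thesis by blast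
    qed (use uv in blast)
  next
    assume uv: "(u, v) \<in> outer_arcs j \<and> ret j u = x"
    then show "(u, v) \<in> parcs H \<and> ret j u = x \<and> ret j v = x"
      using outer_arcs_remaining[OF assms] outer_arcs_ret[OF assms(1), of u v] H_def by auto
  qed
  finally show ?thesis .
qed

text \<open>A primary subgraph with an arc in the branch lies wholly in the fibre over
  \<open>x\<close>. If all of these were bipartite, the parity of the distance to \<open>x\<close>
  would 2-colour the branch.\<close>

lemma nonbip_attachmentsD:
  assumes j: "j < length Ps" and x: "x \<in> nonbip_attachments G Ps j"
  shows "\<exists>i<length Ps. i \<noteq> j \<and> \<not> bipartite (with_proj (Ps ! i)) \<and> (\<forall>v\<in>pverts (Ps ! i). ret j v = x)"
proof (rule ccontr)
  assume none: "\<not> ?thesis"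
  have xP: "x \<in> pverts (Ps ! j)" and nb: "\<not> bipartite (branch G (Ps ! j) x)"
    using x unfolding nonbip_attachments_def by auto
  have "bipartite (branch G (Ps ! j) x)"
  proof (rule bipartite_if_parity[of _ "\<lambda>v. gdist G v x"])
    fix u v assume "u \<rightarrow>\<^bsub>branch G (Ps ! j) x\<^esub> v"
    then have uv: "(u, v) \<in> outer_arcs j" "ret j u = x" using branch_adjacent_iff[OF j xP] by auto
    then obtain i where i: "i < length Ps" "i \<noteq> j" "(u, v) \<in> parcs (Ps ! i)"
      unfolding outer_arcs_def by blast
    have "\<forall>z\<in>pverts (Ps ! i). ret j z = x"
      using ret_primary_const[OF i(1) j i(2)] primary_arc_verts[OF i(1,3)] uv(2) by blast
    then have "bipartite (with_proj (Ps ! i))" using none i by blast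
    then have "even (gdist G u x) \<noteq> even (gdist G v x)"
      using gdist_parity_primary i pverts_subset j xP by blast
    moreover have "ret j v = x" using outer_arcs_ret[OF j uv(1)] uv(2) by simp
    moreover have "u \<in> pverts G" "v \<in> pverts G"
      using uv(1) outer_arcs_subset whole.wellformed' by blast+
    ultimately show "u \<in> verts (branch G (Ps ! j) x) \<and> v \<in> verts (branch G (Ps ! j) x) \<and>
        even (gdist G u x) \<noteq> even (gdist G v x)"
      using verts_branch[OF j xP] uv(2) by simp
  qed
  with nb show False by simp
qed

text \<open>The converse direction: \<open>Ps ! i\<close> lies in one branch at
  \<open>Ps ! j\<close>, and a graph with a non-bipartite subgraph is not bipartite.\<close>

lemma ret_in_nonbip_attachments:
  assumes ij: "i < length Ps" "j < length Ps" "i \<noteq> j"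
    and nb: "\<not> bipartite (with_proj (Ps ! i))" and v: "v \<in> pverts (Ps ! i)"
  shows "ret j v \<in> nonbip_attachments G Ps j"
proof -
  interpret P: connected_pair_graph "Ps ! i" using primary ij by blast
  let ?a = "ret j v"
  have a: "?a \<in> pverts (Ps ! j)" using ret_in pverts_subset ij v by blast
  have const: "ret j z = ?a" if "z \<in> pverts (Ps ! i)" for z
    using ret_primary_const ij v that by blast
  obtain p q where pq: "(p, q) \<in> parcs (Ps ! i)" using P.not_bipartite_equidistant[OF nb v] by blast
  obtain z where z: "z \<in> pverts (Ps ! i)" "z \<noteq> ?a"
    using P.no_loops'[OF pq] P.wellformed'[OF pq] by blast
  \<comment> \<open>The first arc of this outer walk belongs to a primary subgraph other than
    \<open>Ps ! j\<close> that contains \<open>?a\<close>, which makes \<open>?a\<close> an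
    attachment vertex.\<close>
  have "(?a, z) \<in> (outer_arcs j)\<^sup>*"
    using fibre_walk[OF ij(2), of z] const[OF z(1)] pverts_subset ij z(1) by auto
  with z(2) obtain y where "(?a, y) \<in> outer_arcs j" by (metis converse_rtranclE)
  then obtain k where "k < length Ps" "k \<noteq> j" "?a \<in> pverts (Ps ! k)"
    unfolding outer_arcs_def using primary_arc_verts by blast
  then have "?a \<in> attachment_vertices Ps"
    unfolding attachment_vertices_def using ij(2) a by blast
  moreover have "\<not> bipartite (branch G (Ps ! j) ?a)"
  proof
    assume bip: "bipartite (branch G (Ps ! j) ?a)"
    have "bipartite (with_proj (Ps ! i))"
    proof (rule bipartite_subgraph[OF bip])
      show "verts (with_proj (Ps ! i)) \<subseteq> verts (branch G (Ps ! j) ?a)"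
        unfolding verts_branch[OF ij(2) a] using const pverts_subset ij by auto
      fix u w assume "u \<rightarrow>\<^bsub>with_proj (Ps ! i)\<^esub> w"
      then have uw: "(u, w) \<in> parcs (Ps ! i)" by simp
      then show "u \<rightarrow>\<^bsub>branch G (Ps ! j) ?a\<^esub> w"
        unfolding branch_adjacent_iff[OF ij(2) a] outer_arcs_def using ij const P.wellformed' by blast
      show "u \<in> verts (with_proj (Ps ! i)) \<and> w \<in> verts (with_proj (Ps ! i))"
        using P.wellformed'[OF uw] by simp
    qed
    with nb show False by simp
  qed
  ultimately show ?thesis unfolding nonbip_attachments_def using a by simp
qed

text \<open>
  A farthest non-bipartite primary subgraph in the branch at \<open>x\<close> has no other non-bipartite branch
  than the one towards \<open>x\<close>.
\<close>

lemma terminal_nonbip_primary: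
  assumes "j < length Ps" "x \<in> nonbip_attachments G Ps j"
  shows "\<exists>i<length Ps. \<not> bipartite (with_proj (Ps ! i)) \<and>
    (\<forall>v\<in>pverts (Ps ! i). ret j v = x) \<and> (\<exists>y\<in>pverts (Ps ! i). nonbip_attachments G Ps i \<subseteq> {y})"
  using assms
proof (induction "card {v \<in> pverts G. ret j v = x}" arbitrary: j x rule: less_induct)
  case less
  obtain i where i: "i < length Ps" "i \<noteq> j" "\<not> bipartite (with_proj (Ps ! i))"
    "\<forall>v\<in>pverts (Ps ! i). ret j v = x"
    using nonbip_attachmentsD[OF less.prems] by blast
  have x: "x \<in> pverts (Ps ! j)" using less.prems(2) unfolding nonbip_attachments_def by blast
  then have xG: "x \<in> pverts G" using pverts_subset less.prems(1) by blast
  show ?case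
  proof (cases "nonbip_attachments G Ps i \<subseteq> {ret i x}")
    case True
    then show ?thesis using i ret_in xG by blast
  next
    case False
    then obtain c where c: "c \<in> nonbip_attachments G Ps i" "c \<noteq> ret i x" by blast
    then have cP: "c \<in> pverts (Ps ! i)" unfolding nonbip_attachments_def by blast
    \<comment> \<open>The branch of \<open>Ps ! i\<close> at \<open>c\<close> points away from
      \<open>Ps ! j\<close>, so it is contained in the branch at \<open>x\<close>.\<close>
    have sub: "ret j v = x" if v: "v \<in> pverts G" "ret i v = c" for v
    proof -
      have "ret j v = ret j c"
        using ret_swap[OF i(1) less.prems(1) i(2) v(1) x _ cP] v(2) c(2) by blast
      with i(4) cP show ?thesis by simp
    qed
    then have "{v \<in> pverts G. ret i v = c} \<subseteq> {v \<in> pverts G. ret j v = x}" by auto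
    \<comment> \<open>The inclusion is strict because \<open>x\<close> itself is lost, so the
      induction on the size of the fibre applies to \<open>i\<close> and \<open>c\<close>.\<close>
    moreover have "x \<in> {v \<in> pverts G. ret j v = x}" "x \<notin> {v \<in> pverts G. ret i v = c}"
      using xG c(2) ret_id[OF less.prems(1) x] by simp_all
    ultimately have "{v \<in> pverts G. ret i v = c} \<subset> {v \<in> pverts G. ret j v = x}" by blast
    then have "card {v \<in> pverts G. ret i v = c} < card {v \<in> pverts G. ret j v = x}"
      using whole.pair_finite_verts by (intro psubset_card_mono) auto
    then obtain k where k: "k < length Ps" "\<not> bipartite (with_proj (Ps ! k))"
      "\<forall>v\<in>pverts (Ps ! k). ret i v = c" "\<exists>y\<in>pverts (Ps ! k). nonbip_attachments G Ps k \<subseteq> {y}"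
      using less.hyps[OF _ i(1) c(1)] by blast
    then show ?thesis using sub pverts_subset[OF k(1)] by blast
  qed
qed

lemma terminal_generator_nonempty:
  assumes "i < length Ps" "\<not> bipartite (with_proj (Ps ! i))" "y \<in> pverts (Ps ! i)" "C \<subseteq> {y}"
    and "local_metric_generator (Ps ! i) (S \<union> C)"
  shows "S \<noteq> {}"
proof
  assume "S = {}"
  interpret P: connected_pair_graph "Ps ! i" using primary assms by blast
  obtain u v where "(u, v) \<in> parcs (Ps ! i)" "gdist (Ps ! i) u y = gdist (Ps ! i) v y"
    using P.not_bipartite_equidistant assms by blast
  with assms(4,5) \<open>S = {}\<close> show False
    unfolding local_metric_generator_def by fastforce
qed

subsection \<open>The two bounds\<close>

lemma union_generator:
  assumes nb: "\<not> bipartite (with_proj G)"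
    and S: "\<And>j. j \<in> nonbip_indices Ps \<Longrightarrow> S j \<subseteq> pverts (Ps ! j) \<and>
      local_metric_generator (Ps ! j) (S j \<union> nonbip_attachments G Ps j)"
  shows "local_metric_generator G (\<Union>j\<in>nonbip_indices Ps. S j)" (is "local_metric_generator G ?W")
proof -
  have idx: "j \<in> nonbip_indices Ps \<longleftrightarrow> j < length Ps \<and> \<not> bipartite (with_proj (Ps ! j))" for j
    unfolding nonbip_indices_def by simp
  have WG: "?W \<subseteq> pverts G" using S idx pverts_subset by blast
  \<comment> \<open>Every vertex of the set written C_j is imitated by a chosen vertex from its
    branch.\<close>
  have hit: "\<exists>w\<in>?W. ret j w = x" if jx: "j < length Ps" "x \<in> nonbip_attachments G Ps j" for j x
  proof -
    obtain i y where i: "i < length Ps" "\<not> bipartite (with_proj (Ps ! i))"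
      "\<forall>v\<in>pverts (Ps ! i). ret j v = x" "y \<in> pverts (Ps ! i)" "nonbip_attachments G Ps i \<subseteq> {y}"
      using terminal_nonbip_primary[OF jx] by blast
    then have "i \<in> nonbip_indices Ps" using idx by blast
    moreover from this have "S i \<noteq> {}" using terminal_generator_nonempty S i by blast
    ultimately show ?thesis using S i(3) by blast
  qed
  \<comment> \<open>Any one vertex of \<open>?W\<close> distinguishes all edges of bipartite primary
    subgraphs, so at least one is needed.\<close>
  have "?W \<noteq> {}"
  proof -
    obtain j where j: "j \<in> nonbip_indices Ps"
    proof (rule ccontr)
      assume "\<not> thesis"
      with that have bip: "bipartite (with_proj (Ps ! i))" if "i < length Ps" for i
        using idx that by blast
      have "pverts G \<noteq> {}" using nb whole.wellformed' unfolding bipartite_def by auto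
      then obtain w where w: "w \<in> pverts G" by blast
      have "even (gdist G u w) \<noteq> even (gdist G v w)" if "(u, v) \<in> parcs G" for u v
        using that gdist_parity_primary bip w unfolding parcs_eq by blast
      then have "bipartite (with_proj G)"
        by (intro bipartite_if_parity[of _ "\<lambda>u. gdist G u w"]) (auto dest: whole.wellformed')
      with nb show False by simp
    qed
    show ?thesis
    proof (cases "nonbip_attachments G Ps j = {}")
      case False
      then obtain x where "x \<in> nonbip_attachments G Ps j" by blast
      with j idx obtain w where "w \<in> ?W" using hit[of j x] by auto
      then show ?thesis by (metis empty_iff)
    next
      \<comment> \<open>Without non-bipartite branches, \<open>S j\<close> must generate
        \<open>Ps ! j\<close> by itself and cannot be empty.\<close>
      case True
      interpret P: connected_pair_graph "Ps ! j" using primary j idx by blast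
      have nbj: "j < length Ps" "\<not> bipartite (with_proj (Ps ! j))" using j idx by auto
      then have "pverts (Ps ! j) \<noteq> {}" using P.wellformed' unfolding bipartite_def by auto
      then obtain y where "y \<in> pverts (Ps ! j)" by blast
      then have "S j \<noteq> {}"
        using terminal_generator_nonempty[OF nbj, of y "{}" "S j"] S[OF j] True by simp
      then show ?thesis using j by blast
    qed
  qed
  have "\<exists>w\<in>?W. gdist G u w \<noteq> gdist G v w" if uv: "(u, v) \<in> parcs G" for u v
  proof -
    obtain j where j: "j < length Ps" "(u, v) \<in> parcs (Ps ! j)" using uv unfolding parcs_eq by blast
    show ?thesis
    proof (cases "bipartite (with_proj (Ps ! j))")
      case True
      obtain w where w: "w \<in> ?W" using \<open>?W \<noteq> {}\<close> by blast
      then have "even (gdist G u w) \<noteq> even (gdist G v w)"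
        using gdist_parity_primary[OF j(1) True j(2)] subsetD[OF WG w] by simp
      then show ?thesis using w by metis
    next
      case False
      then have jJ: "j \<in> nonbip_indices Ps" using j idx by blast
      then obtain s where s: "s \<in> S j \<union> nonbip_attachments G Ps j"
        "gdist (Ps ! j) u s \<noteq> gdist (Ps ! j) v s"
        using S j(2) unfolding local_metric_generator_def by blast
      have "\<exists>w\<in>?W. ret j w = s"
      proof (cases "s \<in> S j")
        case True
        then have "ret j s = s" using S[OF jJ] ret_id[OF j(1)] by blast
        then show ?thesis using True jJ by blast
      next
        case False
        then show ?thesis using hit j(1) s(1) by blast
      qed
      then obtain w where w: "w \<in> ?W" "ret j w = s" by blast
      then have "gdist G u w \<noteq> gdist G v w"
        using gdist_eq_iff_ret[OF j, of w] subsetD[OF WG w(1)] s(2) by simp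
      then show ?thesis using w(1) by blast
    qed
  qed
  then show ?thesis using WG unfolding local_metric_generator_def by blast
qed

section \<open>The minimum \<open>rho\<close> and the lower bound\<close>

lemma rho_set_finite:
  "finite {card S | S. S \<subseteq> pverts (Ps ! j) \<and>
     local_metric_generator (Ps ! j) (S \<union> nonbip_attachments G Ps j)}"
  if "j < length Ps"
proof -
  interpret P: connected_pair_graph "Ps ! j" using primary that by blast
  have "{card S | S. S \<subseteq> pverts (Ps ! j) \<and>
     local_metric_generator (Ps ! j) (S \<union> nonbip_attachments G Ps j)} \<subseteq> card ` Pow (pverts (Ps ! j))"
    by blast
  then show ?thesis by (rule finite_subset) (simp add: P.pair_finite_verts)
qed

lemma rho_le:
  assumes "j < length Ps" "S \<subseteq> pverts (Ps ! j)"
    "local_metric_generator (Ps ! j) (S \<union> nonbip_attachments G Ps j)"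
  shows "rho G Ps j \<le> card S"
  unfolding rho_def by (rule Min_le[OF rho_set_finite[OF assms(1)]]) (use assms in blast)

lemma rho_witness:
  assumes "j < length Ps"
  shows "\<exists>S. S \<subseteq> pverts (Ps ! j) \<and>
    local_metric_generator (Ps ! j) (S \<union> nonbip_attachments G Ps j) \<and> card S = rho G Ps j"
proof -
  interpret P: connected_pair_graph "Ps ! j" using primary assms by blast
  let ?A = "{card S | S. S \<subseteq> pverts (Ps ! j) \<and>
     local_metric_generator (Ps ! j) (S \<union> nonbip_attachments G Ps j)}"
  \<comment> \<open>The full vertex set is admissible, so the minimum is taken over a nonempty
    set.\<close>
  have "pverts (Ps ! j) \<union> nonbip_attachments G Ps j = pverts (Ps ! j)"
    unfolding nonbip_attachments_def by blast
  then have "card (pverts (Ps ! j)) \<in> ?A" using P.generator_verts by auto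
  then have "rho G Ps j \<in> ?A"
    unfolding rho_def using Min_in[OF rho_set_finite[OF assms]] by blast
  then show ?thesis by auto
qed

lemma sum_rho_le_generator:
  assumes W: "local_metric_generator G W"
  shows "(\<Sum>j\<in>nonbip_indices Ps. rho G Ps j) \<le> card W"
proof -
  let ?C = "nonbip_attachments G Ps" and ?J = "nonbip_indices Ps"
  \<comment> \<open>Subsets of \<open>W\<close> are used instead of their images under
    \<open>ret j\<close>, so that disjointness lets their sizes add up to at most
    \<open>card W\<close>.\<close>
  define T where "T j = {w \<in> W. ret j w \<notin> ?C j}" for j
  have WG: "W \<subseteq> pverts G" using W unfolding local_metric_generator_def by blast
  then have fin: "finite W" using whole.pair_finite_verts finite_subset by blast
  have le: "rho G Ps j \<le> card (T j)" if "j \<in> ?J" for j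
  proof -
    have j: "j < length Ps" using that unfolding nonbip_indices_def by blast
    have sub: "ret j ` W \<subseteq> pverts (Ps ! j)" using ret_in j WG by blast
    have "local_metric_generator (Ps ! j) (ret j ` T j \<union> ?C j)"
      unfolding local_metric_generator_def
    proof (intro conjI allI impI)
      show "ret j ` T j \<union> ?C j \<subseteq> pverts (Ps ! j)"
        using sub unfolding T_def nonbip_attachments_def by blast
      fix u v assume uv: "(u, v) \<in> parcs (Ps ! j)"
      then have "(u, v) \<in> parcs G" using j unfolding parcs_eq by blast
      then obtain w where w: "w \<in> W" "gdist G u w \<noteq> gdist G v w"
        using W unfolding local_metric_generator_def by blast
      then have "gdist (Ps ! j) u (ret j w) \<noteq> gdist (Ps ! j) v (ret j w)"
        using gdist_eq_iff_ret[OF j uv] WG by blast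
      moreover have "ret j w \<in> ret j ` T j \<union> ?C j" using w(1) unfolding T_def by blast
      ultimately show "\<exists>w\<in>ret j ` T j \<union> ?C j. gdist (Ps ! j) u w \<noteq> gdist (Ps ! j) v w" by blast
    qed
    then have "rho G Ps j \<le> card (ret j ` T j)"
      using sub unfolding T_def by (intro rho_le[OF j]) auto
    also have "\<dots> \<le> card (T j)" using fin unfolding T_def by (intro card_image_le) simp
    finally show ?thesis .
  qed
  have disj: "T i \<inter> T j = {}" if ij: "i \<in> ?J" "j \<in> ?J" "i \<noteq> j" for i j
  proof (rule ccontr)
    assume "T i \<inter> T j \<noteq> {}"
    then obtain w where w: "w \<in> pverts G" "ret i w \<notin> ?C i" "ret j w \<notin> ?C j"
      using WG unfolding T_def by blast
    have len: "i < length Ps" "j < length Ps"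
      and nb: "\<not> bipartite (with_proj (Ps ! i))" "\<not> bipartite (with_proj (Ps ! j))"
      using ij unfolding nonbip_indices_def by auto
    have x: "ret i w \<in> pverts (Ps ! i)" and y: "ret j w \<in> pverts (Ps ! j)"
      using ret_in len w(1) by blast+
    \<comment> \<open>As \<open>ret i w\<close> is not in \<open>?C i\<close> but
      \<open>ret i (ret j w)\<close> is, \<open>w\<close> and \<open>Ps ! j\<close> lie on different
      sides of \<open>Ps ! i\<close>. By \<open>ret_swap\<close>, \<open>w\<close> then retracts to
      \<open>Ps ! j\<close> as \<open>Ps ! i\<close> does, hence into \<open>?C j\<close>.\<close>
    have "ret i (ret j w) \<in> ?C i" "ret j (ret i w) \<in> ?C j"
      using ret_in_nonbip_attachments len nb ij(3) x y by blast+
    moreover from this have "ret j w = ret j (ret i w)"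
      using ret_swap[OF len ij(3) w(1) y _ x] w(2) by metis
    ultimately show False using w(3) by simp
  qed
  have "(\<Sum>j\<in>?J. rho G Ps j) \<le> (\<Sum>j\<in>?J. card (T j))" using le by (rule sum_mono)
  also have "\<dots> = card (\<Union>j\<in>?J. T j)"
    by (rule card_UN_disjoint[symmetric]) (use fin disj in \<open>auto simp: T_def nonbip_indices_def\<close>)
  also have "\<dots> \<le> card W" using fin unfolding T_def by (intro card_mono) auto
  finally show ?thesis .
qed

lemma local_metric_dim_eq_sum_rho:
  assumes "\<not> bipartite (with_proj G)"
  shows "local_metric_dim G = (\<Sum>j\<in>nonbip_indices Ps. rho G Ps j)"
proof -
  let ?J = "nonbip_indices Ps" and ?A = "{card W | W. local_metric_generator G W}"
  have "?A \<subseteq> card ` Pow (pverts G)" unfolding local_metric_generator_def by blast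
  then have fin: "finite ?A" by (rule finite_subset) (simp add: whole.pair_finite_verts)
  have "\<forall>j\<in>?J. \<exists>S. S \<subseteq> pverts (Ps ! j) \<and>
      local_metric_generator (Ps ! j) (S \<union> nonbip_attachments G Ps j) \<and> card S = rho G Ps j"
    using rho_witness unfolding nonbip_indices_def by blast
  then obtain S where S: "\<And>j. j \<in> ?J \<Longrightarrow> S j \<subseteq> pverts (Ps ! j) \<and>
      local_metric_generator (Ps ! j) (S j \<union> nonbip_attachments G Ps j) \<and> card (S j) = rho G Ps j"
    by metis
  have gen: "local_metric_generator G (\<Union>j\<in>?J. S j)"
    using union_generator[OF assms] S by blast
  have "finite ?J" unfolding nonbip_indices_def by simp
  then have "card (\<Union>j\<in>?J. S j) \<le> (\<Sum>j\<in>?J. card (S j))" by (rule card_UN_le)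
  also have "\<dots> = (\<Sum>j\<in>?J. rho G Ps j)" using S by simp
  finally have card: "card (\<Union>j\<in>?J. S j) \<le> (\<Sum>j\<in>?J. rho G Ps j)" .
  show ?thesis
  proof (rule antisym)
    have "local_metric_dim G \<le> card (\<Union>j\<in>?J. S j)"
      unfolding local_metric_dim_def by (rule Min_le[OF fin]) (use gen in blast)
    with card show "local_metric_dim G \<le> (\<Sum>j\<in>?J. rho G Ps j)" by simp
    have "local_metric_dim G \<in> ?A"
      unfolding local_metric_dim_def by (rule Min_in[OF fin]) (use gen in blast)
    then show "(\<Sum>j\<in>?J. rho G Ps j) \<le> local_metric_dim G"
      using sum_rho_le_generator by auto
  qed
qed

end

section \<open>Graphs obtained by point-attaching\<close>

lemma connected_pair_graphI:
  assumes "pair_graph G" "connected (with_proj G)"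
  shows "connected_pair_graph G"
proof -
  interpret pair_graph G by fact
  have "strongly_connected (with_proj G)"
    using symmetric_connected_imp_strongly_connected[OF pair_sym_arcs assms(2)] .
  then have "u \<rightarrow>\<^sup>*\<^bsub>with_proj G\<^esub> v" if "u \<in> pverts G" "v \<in> pverts G" for u v
    using that unfolding strongly_connected_def by simp
  then have "(u, v) \<in> (parcs G)\<^sup>*" if "u \<in> pverts G" "v \<in> pverts G" for u v
    using reachable_rtranclI[of "with_proj G" u v] that by simp
  then show ?thesis by unfold_locales
qed

lemma connected_pair_graphI_arcs:
  assumes "finite (pverts G)" "parcs G \<subseteq> pverts G \<times> pverts G" "sym (parcs G)" "irrefl (parcs G)"
    and "\<And>u v. u \<in> pverts G \<Longrightarrow> v \<in> pverts G \<Longrightarrow> (u, v) \<in> (parcs G)\<^sup>*"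
  shows "connected_pair_graph G"
proof -
  have "finite (parcs G)" using assms(1,2) finite_subset by blast
  then show ?thesis
    by unfold_locales (use assms in \<open>auto simp: symmetric_def irrefl_def\<close>)
qed

text \<open>In an attaching step \<open>y\<close> occurs only in the new graph, so the graph built
  so far and its primary subgraphs stay unchanged.\<close>

lemma identify_id:
  assumes "pair_wf_digraph P" "y \<notin> pverts P"
  shows "identify x y P = P"
proof -
  interpret pair_wf_digraph P by fact
  have "id(y := x) ` pverts P = pverts P" using assms(2) by (auto simp: image_iff)
  moreover have "map_prod (id(y := x)) (id(y := x)) e = e" if "e \<in> parcs P" for e
    using that assms(2) wellformed' by (cases e) auto
  then have "map_prod (id(y := x)) (id(y := x)) ` parcs P = parcs P" by simp
  ultimately show ?thesis unfolding identify_def by (simp add: Let_def)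
qed

lemma identify_graph_union:
  "identify x y (graph_union G H) = graph_union (identify x y G) (identify x y H)"
  unfolding identify_def graph_union_def by (simp add: Let_def image_Un)

text \<open>As \<open>x\<close> is not in \<open>H\<close>, the identification merely renames
  \<open>y\<close>; it is injective on \<open>H\<close> and creates no loops.\<close>

lemma connected_pair_graph_identify:
  assumes "connected_pair_graph H" "x \<notin> pverts H"
  shows "connected_pair_graph (identify x y H)"
proof -
  interpret H: connected_pair_graph H by fact
  define f where "f = id(y := x)"
  have V: "pverts (identify x y H) = f ` pverts H"
    and E: "parcs (identify x y H) = map_prod f f ` parcs H"
    unfolding identify_def f_def by (simp_all add: Let_def)
  have inj: "f p \<noteq> f q" if "p \<in> pverts H" "q \<in> pverts H" "p \<noteq> q" for p q
    using that assms(2) unfolding f_def by auto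
  show ?thesis
  proof (rule connected_pair_graphI_arcs)
    show "finite (pverts (identify x y H))" unfolding V using H.pair_finite_verts by simp
    show "parcs (identify x y H) \<subseteq> pverts (identify x y H) \<times> pverts (identify x y H)"
      unfolding V E using H.wellformed' by auto
    show "sym (parcs (identify x y H))"
      unfolding E by (rule symI) (use H.arcs_symmetric in force)
    show "irrefl (parcs (identify x y H))"
      unfolding E using inj H.wellformed' H.no_loops' by (fastforce simp: irrefl_def)
    have "(f p, f q) \<in> (map_prod f f ` parcs H)\<^sup>*" if "(p, q) \<in> (parcs H)\<^sup>*" for p q
      using that
    proof induction
      case (step a b)
      then have "(f a, f b) \<in> map_prod f f ` parcs H" by force
      with step.IH show ?case by (rule rtrancl_into_rtrancl)
    qed simp
    then show "(u, v) \<in> (parcs (identify x y H))\<^sup>*"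
      if "u \<in> pverts (identify x y H)" "v \<in> pverts (identify x y H)" for u v
      using that H.reach unfolding V E by auto
  qed
qed

lemma connected_pair_graph_union:
  assumes "connected_pair_graph G" "connected_pair_graph H" "x \<in> pverts G" "x \<in> pverts H"
  shows "connected_pair_graph (graph_union G H)"
proof -
  interpret G: connected_pair_graph G by fact
  interpret H: connected_pair_graph H by fact
  have V: "pverts (graph_union G H) = pverts G \<union> pverts H"
    and E: "parcs (graph_union G H) = parcs G \<union> parcs H"
    unfolding graph_union_def by simp_all
  show ?thesis
  proof (rule connected_pair_graphI_arcs)
    show "finite (pverts (graph_union G H))"
      unfolding V using G.pair_finite_verts H.pair_finite_verts by simp
    show "parcs (graph_union G H) \<subseteq> pverts (graph_union G H) \<times> pverts (graph_union G H)"
      unfolding V E using G.wellformed' H.wellformed' by auto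
    show "sym (parcs (graph_union G H))"
      unfolding E by (rule symI) (use G.arcs_symmetric H.arcs_symmetric in blast)
    show "irrefl (parcs (graph_union G H))"
      unfolding E irrefl_def using G.no_loops' H.no_loops' by blast
    have sub: "(parcs G)\<^sup>* \<subseteq> (parcs G \<union> parcs H)\<^sup>*" "(parcs H)\<^sup>* \<subseteq> (parcs G \<union> parcs H)\<^sup>*"
      by (rule rtrancl_mono, blast)+
    have "(u, x) \<in> (parcs G \<union> parcs H)\<^sup>*" "(x, u) \<in> (parcs G \<union> parcs H)\<^sup>*"
      if "u \<in> pverts G \<union> pverts H" for u
      using that G.reach H.reach sub assms(3,4) by blast+
    then show "(u, v) \<in> (parcs (graph_union G H))\<^sup>*"
      if "u \<in> pverts (graph_union G H)" "v \<in> pverts (graph_union G H)" for u v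
      using that unfolding V E by (blast intro: rtrancl_trans)
  qed
qed

lemma primary_decomposition_attach:
  assumes "primary_decomposition G Ps ret" "connected_pair_graph H" "pverts G \<inter> pverts H = {x}"
  shows "\<exists>ret'. primary_decomposition (graph_union G H) (Ps @ [H]) ret'"
proof -
  interpret primary_decomposition G Ps ret by fact
  interpret H: connected_pair_graph H by fact
  define m where "m = length Ps"
  \<comment> \<open>The two graphs meet only in \<open>x\<close>: seen from an old primary subgraph
    all of \<open>H\<close> sits at \<open>x\<close>, and seen from \<open>H\<close> (index
    \<open>m\<close>) all of \<open>G\<close> does.\<close>
  define ret' where "ret' j v = (if j < m then ret j (if v \<in> pverts G then v else x)
    else if v \<in> pverts H then v else x)" for j v
  have x: "x \<in> pverts G" "x \<in> pverts H" using assms(3) by blast+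
  have V: "pverts (graph_union G H) = pverts G \<union> pverts H"
    and E: "parcs (graph_union G H) = parcs G \<union> parcs H"
    unfolding graph_union_def by simp_all
  have nth: "(Ps @ [H]) ! i = (if i < m then Ps ! i else H)" if "i < Suc m" for i
    using that unfolding m_def by (auto simp: nth_append less_Suc_eq)
  have len: "length (Ps @ [H]) = Suc m" unfolding m_def by simp
  have onG: "ret' j v = ret j v" if "j < m" "v \<in> pverts G" for j v
    using that unfolding ret'_def by simp
  have onH: "ret' j v = ret j x" if "j < m" "v \<in> pverts H" for j v
    using that assms(3) unfolding ret'_def by auto
  have "primary_decomposition (graph_union G H) (Ps @ [H]) ret'"
  proof (rule primary_decomposition.intro, unfold len)
    show "connected_pair_graph (graph_union G H)"
      by (rule connected_pair_graph_union[OF whole assms(2) x])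
    show "parcs (graph_union G H) = (\<Union>i<Suc m. parcs ((Ps @ [H]) ! i))"
      unfolding E parcs_eq lessThan_Suc m_def by (auto simp: nth_append)
  next
    fix i assume i: "i < Suc m"
    show "connected_pair_graph ((Ps @ [H]) ! i)"
      using primary assms(2) unfolding nth[OF i] m_def by simp
    show "pverts ((Ps @ [H]) ! i) \<subseteq> pverts (graph_union G H)"
      using pverts_subset unfolding nth[OF i] V m_def by auto
  next
    fix j v assume j: "j < Suc m" and v: "v \<in> pverts (graph_union G H)"
    show "ret' j v \<in> pverts ((Ps @ [H]) ! j)"
      using v ret_in x unfolding nth[OF j] ret'_def V m_def by auto
  next
    fix j v assume j: "j < Suc m" and v: "v \<in> pverts ((Ps @ [H]) ! j)"
    show "ret' j v = v"
    proof (cases "j < m")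
      case True
      then have "v \<in> pverts (Ps ! j)" using nth j v by simp
      moreover from this have "v \<in> pverts G" using pverts_subset True unfolding m_def by blast
      ultimately show ?thesis using onG[OF True] ret_id True unfolding m_def by simp
    next
      case False
      then show ?thesis using nth[OF j] v unfolding ret'_def by simp
    qed
  next
    fix j i u v
    assume j: "j < Suc m" and i: "i < Suc m" and ij: "i \<noteq> j" and uv: "(u, v) \<in> parcs ((Ps @ [H]) ! i)"
    consider (GG) "i < m" "j < m" | (GH) "i < m" "j = m" | (HG) "i = m" "j < m"
      using i j ij by linarith
    then show "ret' j u = ret' j v"
    proof cases
      case GG
      then have "(u, v) \<in> parcs (Ps ! i)" using nth i uv by simp
      moreover from this have "u \<in> pverts G" "v \<in> pverts G"
        using GG primary_arc_verts pverts_subset unfolding m_def by blast+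
      ultimately show ?thesis using onG GG ret_arc[of j i u v] ij unfolding m_def by simp
    next
      case GH
      then have "(u, v) \<in> parcs (Ps ! i)" using nth i uv by simp
      then have "u \<in> pverts G" "v \<in> pverts G"
        using GH primary_arc_verts pverts_subset unfolding m_def by blast+
      moreover have "ret' j z = x" if "z \<in> pverts G" for z
      proof -
        have "z = x" if "z \<in> pverts H" using assms(3) \<open>z \<in> pverts G\<close> that by blast
        then show ?thesis using GH(2) unfolding ret'_def by simp
      qed
      ultimately show ?thesis by simp
    next
      case HG
      then have "(u, v) \<in> parcs H" using nth i uv by simp
      then show ?thesis using HG onH H.wellformed' by simp
    qed
  qed
  then show ?thesis by blast
qed

text \<open>The bound on \<open>pverts G\<close> is carried through the induction because it makes
  \<open>G\<close> disjoint from the next graph to be attached.\<close>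

lemma point_attaching_decomposition:
  assumes "point_attaching Gs G Ps"
    and "\<And>i. i < length Gs \<Longrightarrow> connected_pair_graph (Gs ! i)"
    and "\<And>i j. i < length Gs \<Longrightarrow> j < length Gs \<Longrightarrow> i \<noteq> j \<Longrightarrow>
           pverts (Gs ! i) \<inter> pverts (Gs ! j) = {}"
  shows "pverts G \<subseteq> (\<Union>i<length Gs. pverts (Gs ! i)) \<and> (\<exists>ret. primary_decomposition G Ps ret)"
  using assms
proof induction
  case (start G)
  have "connected_pair_graph G" using start(1)[of 0] by simp
  then have "primary_decomposition G [G] (\<lambda>_ v. v)"
    by (intro primary_decomposition.intro) auto
  then show ?case by auto
next
  case (attach Gs G Ps x y H)
  let ?H = "identify x y H"
  have cpg: "connected_pair_graph (Gs ! i)" if "i < length Gs" for i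
    using attach.prems(1)[of i] that by (simp add: nth_append)
  have disj: "pverts (Gs ! i) \<inter> pverts (Gs ! j) = {}"
    if "i < length Gs" "j < length Gs" "i \<noteq> j" for i j
    using attach.prems(2)[of i j] that by (simp add: nth_append)
  have H: "connected_pair_graph H" using attach.prems(1)[of "length Gs"] by simp
  have disjH: "pverts (Gs ! i) \<inter> pverts H = {}" if "i < length Gs" for i
    using attach.prems(2)[of i "length Gs"] that by (simp add: nth_append)
  obtain ret where sub: "pverts G \<subseteq> (\<Union>i<length Gs. pverts (Gs ! i))"
    and dec: "primary_decomposition G Ps ret"
    using attach.IH cpg disj by blast
  interpret primary_decomposition G Ps ret by fact
  interpret H: connected_pair_graph H by fact
  have GH: "pverts G \<inter> pverts H = {}" using sub disjH by blast
  then have y: "y \<notin> pverts G" and x: "x \<notin> pverts H" using attach.hyps by blast+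
  have VH: "pverts ?H = insert x (pverts H - {y})"
    using attach.hyps(3) unfolding identify_def by (auto simp: Let_def image_iff)
  have idG: "identify x y G = G" by (rule identify_id[OF whole.pair_wf_digraph y])
  have idP: "identify x y P = P" if "P \<in> set Ps" for P
  proof -
    obtain i where i: "i < length Ps" "P = Ps ! i" using \<open>P \<in> set Ps\<close> by (metis in_set_conv_nth)
    interpret P: connected_pair_graph P using primary i by simp
    show ?thesis using y pverts_subset i by (intro identify_id[OF P.pair_wf_digraph]) blast
  qed
  have "map (identify x y) (Ps @ [H]) = Ps @ [?H]" using idP by (simp add: map_idI)
  moreover have "identify x y (graph_union G H) = graph_union G ?H"
    by (simp add: identify_graph_union idG)
  moreover have "pverts G \<inter> pverts ?H = {x}" using VH GH attach.hyps(2) by blast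
  moreover have "connected_pair_graph ?H" by (rule connected_pair_graph_identify[OF H x])
  ultimately have ret': "\<exists>ret'. primary_decomposition (identify x y (graph_union G H))
      (map (identify x y) (Ps @ [H])) ret'"
    using primary_decomposition_attach[OF dec, of ?H x] by simp
  have "pverts (graph_union G ?H) \<subseteq> pverts G \<union> pverts H"
    unfolding graph_union_def using VH attach.hyps(2) by auto
  then have "pverts (identify x y (graph_union G H)) \<subseteq> pverts G \<union> pverts H"
    by (simp add: identify_graph_union idG)
  also have "\<dots> \<subseteq> (\<Union>i<length Gs. pverts (Gs ! i)) \<union> pverts H" using sub by (rule Un_mono) simp
  also have "\<dots> = (\<Union>i<length (Gs @ [H]). pverts ((Gs @ [H]) ! i))"
    by (auto simp: nth_append lessThan_Suc)
  finally show ?case using ret' by (rule conjI)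
qed

theorem theorem5:
  fixes Gs Ps :: "'a pair_pre_digraph list" and G :: "'a pair_pre_digraph"
  assumes "\<And>i. i < length Gs \<Longrightarrow> pair_graph (Gs ! i)"
    and "\<And>i. i < length Gs \<Longrightarrow> connected (with_proj (Gs ! i))"
    and "\<And>i. i < length Gs \<Longrightarrow> 2 \<le> card (pverts (Gs ! i))"
    and "\<And>i j. i < length Gs \<Longrightarrow> j < length Gs \<Longrightarrow> i \<noteq> j \<Longrightarrow>
           pverts (Gs ! i) \<inter> pverts (Gs ! j) = {}"
    and "point_attaching Gs G Ps"
    and "\<not> bipartite (with_proj G)"
  shows "local_metric_dim G = (\<Sum>j\<in>nonbip_indices Ps. rho G Ps j)"
proof -
  have "connected_pair_graph (Gs ! i)" if "i < length Gs" for i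
    using connected_pair_graphI assms(1,2) that by blast
  then obtain ret where "primary_decomposition G Ps ret"
    using point_attaching_decomposition[OF assms(5)] assms(4) by blast
  then show ?thesis
    using primary_decomposition.local_metric_dim_eq_sum_rho assms(6) by blast
qed

end
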